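(* Let $\mathcal{H}$ be a separable infinite-dimensional complex Hilbert space, let $T\in\mathcal{B}(\mathcal{H})$ be arbitrary, and let $\{e_n\}_{n\ge1}$ be any orthonormal basis of $\mathcal{H}$. Then there exists an orthonormal basis $\{f_n\}_{n\ge1}$ of $\mathcal{H}$ in which $T$ has the block tridiagonal form $$\begin{pmatrix} C_1 & A_1 & 0 & \\ B_1 & C_2 & A_2 & \\ 0 & B_2 & C_3 & \ddots\\ & & \ddots & \ddots\end{pmatrix}$$ with diagonal block sizes $n_1=1$ and $n_k=2(3^{k-2})$ for $k\ge2$, and such that: (a) each block $B_n$ has the form $B_n=\begin{pmatrix} B_n'\\ 0\end{pmatrix}$, where $B_n'$ is square and upper triangular, i.e., $B_n'(i,j)=0$ if $i>j$; (b) each block $A_n$ is of the form $(A_n'\mid A_n''\mid 0)$, where all three blocks are square and $A_n''$ is lower triangular, i.e., $A_n''(i,j)=0$ if $i<j$ (for $n=1$, where $A_1$ is $1\times2$, the third block is absent); (c) $e_1=f_1$ and $e_n\in\operatorname{span}\{f_1,\dots,f_{3^n}\}$ for all $n\in\mathbb{N}$. Alternatively, there exists an orthonormal basis $\{f_n\}_{n\ge1}$ of $\mathcal{H}$ in which $T$ has a block tridiagonal form $$\begin{pmatrix} C_1 & A_1 & 0 & \\ B_1 & C_2 & A_2 & \\ 0 & B_2 & C_3 & \ddots\\ & & \ddots & \ddots\end{pmatrix}$$ with the same diagonal block sizes $n_1=1$ and $n_k=2(3^{k-2})$ for $k\ge2$, where each $A_n=(A_n'\mid 0)$ with $A_n'$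 square and lower triangular, each $B_n$ has the form $\begin{pmatrix} B_n'\\ B_n''\\ 0\end{pmatrix}$ with square blocks and $B_n''$ upper triangular (for $n=1$ the third block is absent), and $e_1=f_1$ and $e_n\in\operatorname{span}\{f_1,\dots,f_{3^n}\}$ for all $n\in\mathbb{N}$.
   Context: In a block tridiagonal matrix with diagonal block sizes $(n_k)$, $C_k$ is $n_k\times n_k$, $A_k$ is $n_k\times n_{k+1}$, $B_k$ is $n_{k+1}\times n_k$, and all entries outside these blocks are zero. Here the sizes are $1,2,6,18,\dots$, so $n_{k+1}=3n_k$ for $k\ge2$ and $n_2=2n_1$. The matrices $A_k',A_k'',B_k',B_k''$ are $n_k\times n_k$. *)

theory Defs
  imports "HOL-Analysis.Analysis" "Jordan_Normal_Form.Matrix"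
begin

section \<open>Complex Hilbert spaces\<close>

text \<open>The inner product is linear in the first and conjugate-linear in the second argument.\<close>

class complex_inner = real_normed_vector +
  fixes scaleC :: "complex \<Rightarrow> 'a \<Rightarrow> 'a" (infixr \<open>*\<^sub>C\<close> 75)
    and cinner :: "'a \<Rightarrow> 'a \<Rightarrow> complex"
  assumes scaleC_add_right: "c *\<^sub>C (x + y) = c *\<^sub>C x + c *\<^sub>C y"
    and scaleC_add_left: "(c + d) *\<^sub>C x = c *\<^sub>C x + d *\<^sub>C x"
    and scaleC_scaleC: "c *\<^sub>C d *\<^sub>C x = (c * d) *\<^sub>C x"
    and scaleC_one: "1 *\<^sub>C x = x"
    and scaleR_scaleC: "r *\<^sub>R x = complex_of_real r *\<^sub>C x"
    and cinner_commute: "cinner x y = cnj (cinner y x)"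
    and cinner_add_left: "cinner (x + y) z = cinner x z + cinner y z"
    and cinner_scaleC_left: "cinner (c *\<^sub>C x) y = c * cinner x y"
    and cinner_ge_zero: "0 \<le> Re (cinner x x)"
    and cinner_eq_zero_iff: "cinner x x = 0 \<longleftrightarrow> x = 0"
    and norm_eq_sqrt_cinner: "norm x = sqrt (Re (cinner x x))"

class chilbert_space = complex_inner + complete_space

instance chilbert_space \<subseteq> banach ..

global_interpretation complex_vector: vector_space "scaleC :: complex \<Rightarrow> 'a \<Rightarrow> 'a::complex_inner"
  by unfold_locales (simp_all add: scaleC_add_right scaleC_add_left scaleC_scaleC scaleC_one)

definition bounded_clinear :: "('a::complex_inner \<Rightarrow> 'a) \<Rightarrow> bool" where
  "bounded_clinear T \<longleftrightarrow>
     Vector_Spaces.linear scaleC scaleC T \<and> (\<exists>K. \<forall>x. norm (T x) \<le> K * norm x)"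

text \<open>Sequences are indexed by \<open>n \<ge> 1\<close>; the value at \<open>0\<close> is irrelevant.\<close>

definition orthonormal_basis :: "(nat \<Rightarrow> 'a::complex_inner) \<Rightarrow> bool" where
  "orthonormal_basis f \<longleftrightarrow>
     (\<forall>m\<ge>1. \<forall>n\<ge>1. cinner (f m) (f n) = (if m = n then 1 else 0)) \<and>
     closure (complex_vector.span (f ` {1..})) = UNIV"


section \<open>Block matrices of operators\<close>

definition append_cols :: "'a::zero mat \<Rightarrow> 'a mat \<Rightarrow> 'a mat" (infixr \<open>@\<^sub>c\<close> 65) where
  "A @\<^sub>c B = four_block_mat A B (0\<^sub>m 0 (dim_col A)) (0\<^sub>m 0 (dim_col B))"

definition lower_triangular :: "'a::zero mat \<Rightarrow> bool" where
  "lower_triangular A \<longleftrightarrow> (\<forall>i<dim_row A. \<forall>j<dim_col A. i < j \<longrightarrow> A $$ (i, j) = 0)"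

definition matrix_entry :: "('a::complex_inner \<Rightarrow> 'a) \<Rightarrow> (nat \<Rightarrow> 'a) \<Rightarrow> nat \<Rightarrow> nat \<Rightarrow> complex" where
  "matrix_entry T f i j = cinner (T (f j)) (f i)"

text \<open>
  For block sizes \<open>n 1, n 2, \<dots>\<close>, the rows of the \<open>k\<close>-th block row carry the indices
  \<open>block_offset n k + 1, \<dots>, block_offset n k + n k\<close>. Blocks are indexed from \<open>1\<close>, whereas
  entries of the type \<open>mat\<close> are indexed from \<open>0\<close>.
\<close>

definition block_offset :: "(nat \<Rightarrow> nat) \<Rightarrow> nat \<Rightarrow> nat" where
  "block_offset n k = (\<Sum>l\<in>{1..<k}. n l)"

definition block ::
  "(nat \<Rightarrow> nat) \<Rightarrow> ('a::complex_inner \<Rightarrow> 'a) \<Rightarrow> (nat \<Rightarrow> 'a) \<Rightarrow> nat \<Rightarrow> nat \<Rightarrow> complex mat" where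
  "block n T f k l =
     mat (n k) (n l) (\<lambda>(i, j). matrix_entry T f (block_offset n k + i + 1) (block_offset n l + j + 1))"

definition block_tridiagonal ::
  "(nat \<Rightarrow> nat) \<Rightarrow> ('a::complex_inner \<Rightarrow> 'a) \<Rightarrow> (nat \<Rightarrow> 'a) \<Rightarrow> bool" where
  "block_tridiagonal n T f \<longleftrightarrow>
     (\<forall>k\<ge>1. \<forall>l\<ge>1. k + 1 < l \<or> l + 1 < k \<longrightarrow> block n T f k l = 0\<^sub>m (n k) (n l))"

text \<open>The off-diagonal blocks \<open>A\<^sub>k\<close> and \<open>B\<^sub>k\<close>.\<close>

abbreviation upper_block ::
  "(nat \<Rightarrow> nat) \<Rightarrow> ('a::complex_inner \<Rightarrow> 'a) \<Rightarrow> (nat \<Rightarrow> 'a) \<Rightarrow> nat \<Rightarrow> complex mat" where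
  "upper_block n T f k \<equiv> block n T f k (k + 1)"

abbreviation lower_block ::
  "(nat \<Rightarrow> nat) \<Rightarrow> ('a::complex_inner \<Rightarrow> 'a) \<Rightarrow> (nat \<Rightarrow> 'a) \<Rightarrow> nat \<Rightarrow> complex mat" where
  "lower_block n T f k \<equiv> block n T f (k + 1) k"

definition bsize :: "nat \<Rightarrow> nat" where
  "bsize k = (if k = 1 then 1 else 2 * 3 ^ (k - 2))"

end

theory Submission
  imports Defs
begin

text \<open>
  Run Gram--Schmidt on a sequence of vectors that is chosen along the way: \<open>f 1 = e 1\<close>, and once
  the blocks up to the \<open>k\<close>-th are filled, the next block absorbs \<open>U g\<close> for each \<open>g\<close> in the \<open>k\<close>-th
  block, then \<open>V g\<close> for each such \<open>g\<close>, and finally, for \<open>k \<ge> 2\<close>, the vector \<open>e k\<close>. A prescribed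
  vector that already lies in the span gives no new direction; infinite dimension then supplies an
  arbitrary one. With \<open>(U, V) = (T, T*)\<close> this gives the first form and with \<open>(T*, T)\<close> the second.
\<close>

section \<open>The inner product\<close>

lemma cinner_add_right: "cinner x (y + z) = cinner x y + cinner x z"
  for x :: "'a::complex_inner"
  by (metis cinner_add_left cinner_commute complex_cnj_add)

lemma cinner_scaleC_right: "cinner x (c *\<^sub>C y) = cnj c * cinner x y"
  for x :: "'a::complex_inner"
  by (metis cinner_commute cinner_scaleC_left complex_cnj_mult)

lemma cinner_zero_left [simp]: "cinner 0 y = 0"
  for y :: "'a::complex_inner"
  by (metis add_cancel_right_right cinner_add_left)

lemma cinner_zero_right [simp]: "cinner y 0 = 0"
  for y :: "'a::complex_inner"
  by (metis cinner_commute cinner_zero_left complex_cnj_zero)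

lemma cinner_diff_left: "cinner (x - y) z = cinner x z - cinner y z"
  for x :: "'a::complex_inner"
  by (metis add_diff_cancel_right' cinner_add_left diff_add_cancel)

lemma cinner_diff_right: "cinner z (x - y) = cinner z x - cinner z y"
  for x :: "'a::complex_inner"
  by (metis add_diff_cancel_right' cinner_add_right diff_add_cancel)

lemma cinner_sum_left: "cinner (\<Sum>i\<in>A. g i) y = (\<Sum>i\<in>A. cinner (g i) y)"
  for y :: "'a::complex_inner"
  by (induction A rule: infinite_finite_induct) (simp_all add: cinner_add_left)

lemma cinner_sum_right: "cinner y (\<Sum>i\<in>A. g i) = (\<Sum>i\<in>A. cinner y (g i))"
  for y :: "'a::complex_inner"
  by (induction A rule: infinite_finite_induct) (simp_all add: cinner_add_right)

lemma cinner_self: "cinner x x = complex_of_real ((norm x)\<^sup>2)"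
  for x :: "'a::complex_inner"
proof -
  have "Im (cinner x x) = - Im (cinner x x)"
    using arg_cong[OF cinner_commute[of x x], of Im] by simp
  moreover have "(norm x)\<^sup>2 = Re (cinner x x)"
    using cinner_ge_zero[of x] by (simp add: norm_eq_sqrt_cinner)
  ultimately show ?thesis
    by (simp add: complex_eq_iff)
qed

lemma norm_scaleC: "norm (c *\<^sub>C x) = cmod c * norm x"
  for x :: "'a::complex_inner"
proof -
  have "complex_of_real ((norm (c *\<^sub>C x))\<^sup>2) = (c * cnj c) * complex_of_real ((norm x)\<^sup>2)"
    by (simp only: cinner_self[symmetric] cinner_scaleC_left cinner_scaleC_right mult_ac)
  also have "\<dots> = complex_of_real ((cmod c * norm x)\<^sup>2)"
    by (simp only: complex_norm_square[symmetric] power_mult_distrib of_real_mult)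
  finally have "(norm (c *\<^sub>C x))\<^sup>2 = (cmod c * norm x)\<^sup>2"
    by (simp only: of_real_eq_iff)
  then show ?thesis
    by simp
qed

text \<open>Cauchy--Schwarz: \<open>c *\<^sub>C y\<close> is the orthogonal projection of
  \<open>x\<close> onto the line of \<open>y\<close>, and Pythagoras bounds its norm by that of
  \<open>x\<close>.\<close>

lemma cinner_norm_le: "cmod (cinner x y) \<le> norm x * norm y"
  for x :: "'a::complex_inner"
proof (cases "y = 0")
  case False
  define c where "c = cinner x y / cinner y y"
  have yy: "cinner y y \<noteq> 0"
    using False by (simp add: cinner_eq_zero_iff)
  have orth: "cinner (x - c *\<^sub>C y) y = 0"
    using yy by (simp add: cinner_diff_left cinner_scaleC_left c_def)
  have "cinner x x = cinner (x - c *\<^sub>C y) (x - c *\<^sub>C y) + cinner (c *\<^sub>C y) (c *\<^sub>C y)"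
    using orth cinner_commute[of y "x - c *\<^sub>C y"]
    by (simp add: cinner_diff_left cinner_diff_right cinner_scaleC_left cinner_scaleC_right algebra_simps)
  then have "complex_of_real ((norm x)\<^sup>2) =
      complex_of_real ((norm (x - c *\<^sub>C y))\<^sup>2 + (norm (c *\<^sub>C y))\<^sup>2)"
    by (simp only: cinner_self of_real_add)
  then have "(norm x)\<^sup>2 = (norm (x - c *\<^sub>C y))\<^sup>2 + (norm (c *\<^sub>C y))\<^sup>2"
    by (simp only: of_real_eq_iff)
  then have "(norm (c *\<^sub>C y))\<^sup>2 \<le> (norm x)\<^sup>2"
    by simp
  then have "norm (c *\<^sub>C y) \<le> norm x"
    by (rule power2_le_imp_le) simp
  moreover have "cmod (cinner x y) = norm (c *\<^sub>C y) * norm y"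
    using False by (simp add: norm_scaleC c_def cinner_self norm_divide norm_mult power2_eq_square)
  ultimately show ?thesis
    by (simp add: mult_right_mono)
qed simp

lemma bounded_linear_cinner_left: "bounded_linear (\<lambda>x::'a::complex_inner. cinner x y)"
  by (rule bounded_linear_intro[where K = "norm y"])
    (simp_all add: cinner_add_left scaleR_scaleC cinner_scaleC_left cinner_norm_le scaleR_conv_of_real)

lemma bounded_clinear_imp_bounded_linear:
  assumes "bounded_clinear T"
  shows "bounded_linear T"
proof -
  interpret T: Vector_Spaces.linear scaleC scaleC T
    using assms by (simp add: bounded_clinear_def)
  obtain K where "\<And>x. norm (T x) \<le> K * norm x"
    using assms by (auto simp: bounded_clinear_def)
  then show ?thesis
    by (intro bounded_linear_intro[where K = K])
      (simp_all add: T.add T.scale scaleR_scaleC mult.commute)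
qed

lemma cinner_span_left_eq_0:
  assumes "x \<in> complex_vector.span S" and "\<And>s. s \<in> S \<Longrightarrow> cinner s y = 0"
  shows "cinner x y = 0"
  using assms
  by (induction rule: complex_vector.span_induct_alt)
    (simp_all add: cinner_add_left cinner_scaleC_left)


section \<open>The adjoint\<close>

lemma orthonormal_basis_cinner:
  assumes "orthonormal_basis e" and "m \<ge> 1" and "n \<ge> 1"
  shows "cinner (e m) (e n) = (if m = n then 1 else 0)"
  using assms by (simp add: orthonormal_basis_def)

text \<open>Pythagoras. The shift to \<open>e (Suc i)\<close> lets series indexed from 0 run through
  a basis indexed from 1.\<close>

lemma norm_orthonormal_sum:
  fixes c :: "nat \<Rightarrow> complex"
  assumes "orthonormal_basis e" and "finite A"
  shows "(norm (\<Sum>i\<in>A. c i *\<^sub>C e (Suc i)))\<^sup>2 = (\<Sum>i\<in>A. (cmod (c i))\<^sup>2)"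
proof -
  have "cinner (\<Sum>i\<in>A. c i *\<^sub>C e (Suc i)) (\<Sum>i\<in>A. c i *\<^sub>C e (Suc i)) =
      (\<Sum>i\<in>A. \<Sum>j\<in>A. if i = j then c i * cnj (c i) else 0)"
    by (auto simp: cinner_sum_left cinner_sum_right cinner_scaleC_left cinner_scaleC_right
        orthonormal_basis_cinner[OF assms(1)] sum_distrib_left intro!: sum.cong)
  also have "\<dots> = (\<Sum>i\<in>A. c i * cnj (c i))"
    using assms(2) by simp
  also have "\<dots> = complex_of_real (\<Sum>i\<in>A. (cmod (c i))\<^sup>2)"
    unfolding of_real_sum by (simp only: complex_norm_square)
  finally show ?thesis
    by (simp only: cinner_self of_real_eq_iff)
qed

text \<open>Riesz representation in coordinates: the coefficients of \<open>w\<close> in the basis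
  \<open>e\<close> are forced. They turn out square summable, so completeness provides
  \<open>w\<close>, and density of the span carries the identity from the basis to all
  \<open>x\<close>.\<close>

lemma adjoint_vector_exists:
  fixes T :: "'a::chilbert_space \<Rightarrow> 'a"
  assumes T: "bounded_clinear T" and e: "orthonormal_basis (e :: nat \<Rightarrow> 'a)"
  shows "\<exists>w. \<forall>x. cinner (T x) y = cinner x w"
proof -
  interpret T: Vector_Spaces.linear scaleC scaleC T
    using T by (simp add: bounded_clinear_def)
  have bl: "bounded_linear T"
    using T by (rule bounded_clinear_imp_bounded_linear)
  obtain K where K: "\<And>x. norm (T x) \<le> norm x * K"
    using bounded_linear.bounded[OF bl] by blast
  define c where "c i = cnj (cinner (T (e (Suc i))) y)" for i
  define g where "g i = c i *\<^sub>C e (Suc i)" for i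
  \<comment> \<open>Bessel-type bound: evaluating at the partial sum \<open>?w\<close> gives
    \<open>cinner (T ?w) y = ?S\<close>, while \<open>?S\<close> is also the squared norm of
    \<open>?w\<close>; boundedness of \<open>T\<close> then allows one factor \<open>norm ?w\<close>
    to be cancelled.\<close>
  have "(\<Sum>i\<in>A. (cmod (c i))\<^sup>2) \<le> (K * norm y)\<^sup>2" if A: "finite A" for A
  proof -
    let ?S = "\<Sum>i\<in>A. (cmod (c i))\<^sup>2" and ?w = "\<Sum>i\<in>A. g i"
    have S: "?S = (norm ?w)\<^sup>2"
      using norm_orthonormal_sum[OF e A, of c] by (simp add: g_def)
    have "cinner (T ?w) y = (\<Sum>i\<in>A. c i * cnj (c i))"
      by (simp add: T.sum g_def T.scale cinner_sum_left cinner_scaleC_left c_def)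
    also have "\<dots> = complex_of_real ?S"
      unfolding of_real_sum by (simp only: complex_norm_square)
    finally have "cmod (cinner (T ?w) y) = ?S"
      by (simp only: norm_of_real abs_of_nonneg sum_nonneg zero_le_power2)
    then have "?S \<le> norm (T ?w) * norm y"
      using cinner_norm_le[of "T ?w" y] by simp
    also have "\<dots> \<le> norm ?w * K * norm y"
      by (intro mult_right_mono K) simp
    finally have "norm ?w * norm ?w \<le> norm ?w * (K * norm y)"
      unfolding S by (simp add: power2_eq_square mult.assoc)
    then have "norm ?w \<le> K * norm y \<or> norm ?w = 0"
      by (auto simp: mult_le_cancel_left)
    then show ?thesis
      unfolding S by (auto intro: power_mono)
  qed
  then have "summable (\<lambda>i. (cmod (c i))\<^sup>2)"
    by (intro summableI_nonneg_bounded[where x = "(K * norm y)\<^sup>2"]) simp_all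
  then have sq: "\<exists>N. \<forall>m\<ge>N. \<forall>n. norm (\<Sum>i=m..<n. (cmod (c i))\<^sup>2) < r" if "r > 0" for r
    using that by (simp add: summable_Cauchy)
  \<comment> \<open>By orthonormality the squared norm of a section of this series is a section of
    the convergent series of squares, so the Cauchy criterion transfers.\<close>
  have "summable g"
    unfolding summable_Cauchy
  proof (intro allI impI)
    fix r :: real
    assume r: "r > 0"
    then obtain N where N: "\<And>m n. m \<ge> N \<Longrightarrow> norm (\<Sum>i=m..<n. (cmod (c i))\<^sup>2) < r\<^sup>2"
      using sq[of "r\<^sup>2"] by auto
    have "norm (sum g {m..<n}) < r" if "m \<ge> N" for m n
    proof -
      have "(norm (sum g {m..<n}))\<^sup>2 < r\<^sup>2"
        using N[OF that, of n] norm_orthonormal_sum[OF e, of "{m..<n}" c]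
        by (simp add: g_def[abs_def] sum_nonneg)
      then show ?thesis
        using r by (intro power2_less_imp_less[of _ r]) auto
    qed
    then show "\<exists>N. \<forall>m\<ge>N. \<forall>n. norm (sum g {m..<n}) < r"
      by blast
  qed
  then have sums: "g sums suminf g"
    by (rule summable_sums)
  define w where "w = suminf g"
  have coeff: "cinner (e n) w = cinner (T (e n)) y" if "n \<ge> 1" for n
  proof -
    have "(\<lambda>i. cinner (g i) (e n)) sums cinner w (e n)"
      unfolding w_def by (rule bounded_linear.sums[OF bounded_linear_cinner_left sums])
    moreover have "(\<lambda>i. cinner (g i) (e n)) = (\<lambda>i. if i = n - 1 then c i else 0)"
      using that by (auto simp: fun_eq_iff g_def cinner_scaleC_left orthonormal_basis_cinner[OF e])
    ultimately have "cinner w (e n) = c (n - 1)"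
      using sums_unique2 sums_single by metis
    then show ?thesis
      using that cinner_commute[of "e n" w] by (simp add: c_def)
  qed
  \<comment> \<open>A closed set, by continuity of both sides; it contains the span of the basis,
    which is dense.\<close>
  let ?V = "{x. cinner (T x) y = cinner x w}"
  have "complex_vector.span (e ` {1..}) \<subseteq> ?V"
  proof
    fix x
    assume "x \<in> complex_vector.span (e ` {1..})"
    then show "x \<in> ?V"
      by (induction rule: complex_vector.span_induct_alt)
        (auto simp: T.zero T.add T.scale cinner_add_left cinner_scaleC_left coeff)
  qed
  moreover have "closed ?V"
    using bounded_linear_compose[OF bounded_linear_cinner_left bl]
    by (intro closed_Collect_eq linear_continuous_on bounded_linear_cinner_left)
  ultimately have "closure (complex_vector.span (e ` {1..})) \<subseteq> ?V"
    by (rule closure_minimal)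
  then show ?thesis
    using e by (auto simp: orthonormal_basis_def)
qed

lemma adjoint_exists:
  fixes T :: "'a::chilbert_space \<Rightarrow> 'a"
  assumes "bounded_clinear T" and "orthonormal_basis (e :: nat \<Rightarrow> 'a)"
  obtains S where "\<And>x y. cinner (T x) y = cinner x (S y)"
  using adjoint_vector_exists[OF assms] by metis


section \<open>Gram--Schmidt with prescribed vectors\<close>

text \<open>One Gram--Schmidt step: subtract from a vector outside the span its projection and
  normalise. If \<open>v\<close> is already in the span, any outside vector serves, and infinite
  dimension supplies one.\<close>

lemma orthonormal_extend:
  fixes f :: "nat \<Rightarrow> 'a::complex_inner" and v :: 'a
  assumes inf: "\<not> (\<exists>S :: 'a set. finite S \<and> complex_vector.span S = UNIV)"
    and fin: "finite A"
    and orth: "\<And>i j. i \<in> A \<Longrightarrow> j \<in> A \<Longrightarrow> cinner (f i) (f j) = (if i = j then 1 else 0)"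
  shows "\<exists>r. cinner r r = 1 \<and> (\<forall>i\<in>A. cinner r (f i) = 0) \<and>
    v \<in> complex_vector.span (insert r (f ` A))"
proof -
  let ?S = "complex_vector.span (f ` A)"
  have "?S \<noteq> UNIV"
    using inf fin by blast
  then obtain x where x: "x \<notin> ?S" and vx: "v \<in> ?S \<or> v = x"
    by auto
  define p where "p = (\<Sum>i\<in>A. cinner x (f i) *\<^sub>C f i)"
  have p: "p \<in> ?S"
    unfolding p_def
    by (intro complex_vector.span_sum complex_vector.span_scale complex_vector.span_base) auto
  define q where "q = x - p"
  have q0: "q \<noteq> 0"
    using x p by (auto simp: q_def)
  have q: "cinner q (f i) = 0" if "i \<in> A" for i
  proof -
    have "cinner p (f i) = (\<Sum>j\<in>A. if j = i then cinner x (f j) else 0)"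
      unfolding p_def cinner_sum_left
      using that by (intro sum.cong) (auto simp: cinner_scaleC_left orth)
    then show ?thesis
      using fin that by (simp add: q_def cinner_diff_left)
  qed
  define r where "r = complex_of_real (inverse (norm q)) *\<^sub>C q"
  have "cinner r r = 1"
    using q0 by (simp add: cinner_self r_def norm_scaleC norm_inverse del: of_real_inverse)
  moreover have "\<forall>i\<in>A. cinner r (f i) = 0"
    by (simp add: r_def cinner_scaleC_left q)
  moreover have "v \<in> complex_vector.span (insert r (f ` A))"
  proof -
    let ?R = "complex_vector.span (insert r (f ` A))"
    have sub: "?S \<subseteq> ?R"
      by (intro complex_vector.span_mono) auto
    have "complex_of_real (norm q) *\<^sub>C r = q"
      using q0 by (simp add: r_def scaleC_scaleC scaleC_one flip: of_real_mult)
    then have "q \<in> ?R"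
      by (metis complex_vector.span_base complex_vector.span_scale insertI1)
    then have "q + p \<in> ?R"
      using p sub by (intro complex_vector.span_add) auto
    then show ?thesis
      using vx sub by (auto simp: q_def)
  qed
  ultimately show ?thesis
    by blast
qed

text \<open>\<open>D f m\<close> is the vector to be absorbed at stage \<open>m\<close>. It may
  depend on the part of the sequence built before, which is what lets images of earlier basis
  vectors be prescribed.\<close>

lemma orthonormal_sequence_exists:
  fixes D :: "(nat \<Rightarrow> 'a::complex_inner) \<Rightarrow> nat \<Rightarrow> 'a"
  assumes inf: "\<not> (\<exists>S :: 'a set. finite S \<and> complex_vector.span S = UNIV)"
    and D: "\<And>f g m. (\<And>i. i < m \<Longrightarrow> f i = g i) \<Longrightarrow> m \<ge> 1 \<Longrightarrow> D f m = D g m"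
    and u: "cinner u u = 1" "\<And>f. D f 1 = u"
  shows "\<exists>f. (\<forall>m\<ge>1. \<forall>n\<ge>1. cinner (f m) (f n) = (if m = n then 1 else 0)) \<and>
    f 1 = u \<and> (\<forall>m\<ge>1. D f m \<in> complex_vector.span (f ` {1..m}))"
proof -
  \<comment> \<open>The admissible choices at stage \<open>m\<close>. Index 0 is left free, and the
    last clause pins the first vector to \<open>u\<close> itself rather than to some unit vector on
    the same line.\<close>
  define P where "P f m r \<longleftrightarrow> (m \<ge> 1 \<longrightarrow> cinner r r = 1 \<and> (\<forall>i\<in>{1..<m}. cinner r (f i) = 0) \<and>
      D f m \<in> complex_vector.span (insert r (f ` {1..<m})) \<and> (m = 1 \<longrightarrow> r = u))"
    for f :: "nat \<Rightarrow> 'a" and m r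
  have "\<exists>f. \<forall>m. P f m (f m)"
  proof (rule dependent_wellorder_choice)
    fix r m and f g :: "nat \<Rightarrow> 'a"
    assume fg: "\<And>y::nat. y < m \<Longrightarrow> f y = g y"
    then have "f ` {1..<m} = g ` {1..<m}"
      by (intro image_cong) auto
    then show "P f m r = P g m r"
      using fg D[of m f g] by (auto simp: P_def)
  next
    fix m and f :: "nat \<Rightarrow> 'a"
    assume prev: "\<And>y. y < m \<Longrightarrow> P f y (f y)"
    show "\<exists>r. P f m r"
    proof (cases "m = 1")
      case True
      have "P f m u"
        using u(1) by (simp add: P_def True u(2)[simplified] complex_vector.span_base)
      then show ?thesis ..
    next
      case False
      \<comment> \<open>\<open>P\<close> records orthogonality only to smaller indices; conjugate
        symmetry gives the other order.\<close>
      have "cinner (f i) (f j) = (if i = j then 1 else 0)" if "i \<in> {1..<m}" "j \<in> {1..<m}" for i j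
      proof (cases i j rule: linorder_cases)
        case less
        then have "cinner (f j) (f i) = 0"
          using prev[of j] that by (auto simp: P_def)
        then show ?thesis
          using less cinner_commute[of "f i" "f j"] by simp
      qed (use prev[of i] that in \<open>auto simp: P_def\<close>)
      then show ?thesis
        using orthonormal_extend[OF inf, of "{1..<m}" f "D f m"] False by (auto simp: P_def)
    qed
  qed
  then obtain f where f: "\<And>m. P f m (f m)"
    by blast
  have "cinner (f i) (f j) = (if i = j then 1 else 0)" if "i \<ge> 1" "j \<ge> 1" for i j
  proof (cases i j rule: linorder_cases)
    case less
    then have "cinner (f j) (f i) = 0"
      using f[of j] that by (auto simp: P_def)
    then show ?thesis
      using less cinner_commute[of "f i" "f j"] by simp
  qed (use f[of i] that in \<open>auto simp: P_def\<close>)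
  moreover have "D f m \<in> complex_vector.span (f ` {1..m})" if "m \<ge> 1" for m
  proof -
    have "insert (f m) (f ` {1..<m}) = f ` {1..m}"
      using that by (auto simp: image_iff le_less)
    then show ?thesis
      using f[of m] that by (simp add: P_def)
  qed
  moreover have "f 1 = u"
    using f[of 1] by (simp add: P_def)
  ultimately show ?thesis
    by blast
qed


section \<open>Block sizes and the staircase basis\<close>

lemma bsize_pos: "bsize k > 0"
  by (simp add: bsize_def)

text \<open>Block \<open>k + 1\<close> has one share of \<open>bsize k\<close> places for the images
  under \<open>U\<close>, one for those under \<open>V\<close>, and a third for \<open>e k\<close>.
  The third is missing at \<open>k = 1\<close>, where \<open>e 1\<close> is already the first basis
  vector.\<close>

lemma bsize_Suc: "k \<ge> 1 \<Longrightarrow> bsize (Suc k) = 2 * bsize k + (if k = 1 then 0 else bsize k)"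
  by (cases k rule: nat.exhaust; cases "k - 1") (auto simp: bsize_def)

lemma block_offset_Suc: "k \<ge> 1 \<Longrightarrow> block_offset n (Suc k) = block_offset n k + n k"
  by (simp add: block_offset_def)

lemma block_offset_mono: "k \<le> l \<Longrightarrow> block_offset n k \<le> block_offset n l"
  by (auto simp: block_offset_def intro!: sum_mono2)

text \<open>The first \<open>k + 1\<close> blocks end at index \<open>3 ^ k\<close>; this is the
  source of the bound \<open>3 ^ n\<close> in the condition on \<open>e n\<close>.\<close>

lemma block_offset_bsize: "block_offset bsize (Suc (Suc k)) = 3 ^ k"
proof (induction k)
  case 0
  then show ?case
    by (simp add: block_offset_def bsize_def)
next
  case (Suc k)
  then show ?case
    by (subst block_offset_Suc) (simp_all, simp add: bsize_def)
qed

text \<open>The predicate says that the part of the matrix of \<open>U\<close> below the diagonal blocks is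
  upper triangular, shifted down by \<open>d\<close> squares.\<close>

definition staircase :: "nat \<Rightarrow> ('a::complex_inner \<Rightarrow> 'a) \<Rightarrow> (nat \<Rightarrow> 'a) \<Rightarrow> bool" where
  "staircase d U f \<longleftrightarrow> (\<forall>k\<ge>1. \<forall>j<bsize k. U (f (block_offset bsize k + j + 1)) \<in>
     complex_vector.span (f ` {1..block_offset bsize (k + 1) + d * bsize k + j + 1}))"

lemma staircase_basis_exists:
  fixes U V :: "'a::complex_inner \<Rightarrow> 'a"
  assumes inf: "\<not> (\<exists>S :: 'a set. finite S \<and> complex_vector.span S = UNIV)"
    and e: "orthonormal_basis e"
  shows "\<exists>f. orthonormal_basis f \<and> staircase 0 U f \<and> staircase 1 V f \<and>
    e 1 = f 1 \<and> (\<forall>n\<ge>1. e n \<in> complex_vector.span (f ` {1..3 ^ n}))"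
proof -
  let ?o = "block_offset bsize"
  \<comment> \<open>For \<open>m > 1\<close>, \<open>lev m = k\<close> says that \<open>m\<close>
    lies in block \<open>k + 1\<close>, which occupies the indices from
    \<open>3 ^ (k - 1) + 1\<close> to \<open>3 ^ k\<close>.\<close>
  define lev :: "nat \<Rightarrow> nat" where "lev m = (LEAST k. m \<le> 3 ^ k)" for m
  have lev: "lev (?o (Suc k) + j) = k" if "k \<ge> 1" "j \<ge> 1" "j \<le> bsize (Suc k)" for k j
    unfolding lev_def
  proof (rule Least_equality)
    have "?o (Suc k) + bsize (Suc k) = 3 ^ k"
      using block_offset_bsize[of k] by (simp add: block_offset_Suc)
    then show "?o (Suc k) + j \<le> 3 ^ k"
      using that by linarith
    fix l
    assume l: "?o (Suc k) + j \<le> 3 ^ l"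
    show "k \<le> l"
    proof (rule ccontr)
      assume "\<not> k \<le> l"
      then have "(3::nat) ^ l \<le> 3 ^ (k - 1)"
        by (intro power_increasing) auto
      moreover have "?o (Suc k) = 3 ^ (k - 1)"
        using block_offset_bsize[of "k - 1"] that by simp
      ultimately show False
        using l that by linarith
    qed
  qed
  \<comment> \<open>Here \<open>j\<close> is the position of \<open>m\<close> inside block
    \<open>k + 1\<close>, counted from 1. All positions after the first two shares prescribe
    \<open>e k\<close>; the repetitions merely fill the block.\<close>
  define D where "D f m = (if m = 1 then e 1 else let k = lev m; j = m - ?o (Suc k) in
      if j \<le> bsize k then U (f (?o k + j))
      else if j \<le> 2 * bsize k then V (f (?o k + (j - bsize k))) else e k)" for f m
  have dep: "D f m = D g m" if fg: "\<And>i. i < m \<Longrightarrow> f i = g i" and m: "m \<ge> 1" for f g m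
  proof (cases "m = 1")
    case False
    define k where "k = lev m"
    have "k \<noteq> 0"
    proof
      assume "k = 0"
      have "m \<le> 3 ^ k"
        unfolding k_def lev_def by (rule LeastI[of _ m]) (simp add: less_imp_le)
      then show False
        using \<open>k = 0\<close> m False by simp
    qed
    have "\<not> m \<le> 3 ^ (k - 1)"
      using \<open>k \<noteq> 0\<close> not_less_Least[of "k - 1" "\<lambda>k. m \<le> 3 ^ k"] by (simp add: k_def lev_def)
    then have "m > ?o (Suc k)"
      using block_offset_bsize[of "k - 1"] \<open>k \<noteq> 0\<close> by simp
    moreover have "?o (Suc k) > ?o k"
      using block_offset_Suc[of k bsize] bsize_pos[of k] \<open>k \<noteq> 0\<close> by simp
    \<comment> \<open>The recursion is well founded: moving from block \<open>k + 1\<close> back to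
      block \<open>k\<close> strictly lowers the index, so \<open>D\<close> reads only values
      already chosen.\<close>
    ultimately have "?o k + (m - ?o (Suc k)) < m" "?o k + (m - ?o (Suc k) - bsize k) < m"
      by linarith+
    then show ?thesis
      using False by (simp add: D_def Let_def fg flip: k_def)
  qed (simp add: D_def)
  obtain f where orth: "\<forall>m\<ge>1. \<forall>n\<ge>1. cinner (f m) (f n) = (if m = n then 1 else 0)"
    and f1: "f 1 = e 1" and f: "\<And>m. m \<ge> 1 \<Longrightarrow> D f m \<in> complex_vector.span (f ` {1..m})"
  proof -
    have "cinner (e 1) (e 1) = 1" "\<And>f. D f 1 = e 1"
      using orthonormal_basis_cinner[OF e, of 1 1] by (simp_all add: D_def)
    from orthonormal_sequence_exists[of D, OF inf dep this] that show ?thesis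
      by blast
  qed
  have D_block: "D f (?o (Suc k) + j) = (if j \<le> bsize k then U (f (?o k + j))
      else if j \<le> 2 * bsize k then V (f (?o k + (j - bsize k))) else e k)"
    if "k \<ge> 1" "j \<ge> 1" "j \<le> bsize (Suc k)" for k j
  proof -
    have "?o (Suc k) \<ge> 1"
      using block_offset_bsize[of "k - 1"] that by simp
    then have "?o (Suc k) + j \<noteq> 1"
      using that by linarith
    then show ?thesis
      using that by (simp add: D_def lev Let_def)
  qed
  have "staircase 0 U f"
    unfolding staircase_def
  proof (intro allI impI)
    fix k j
    assume k: "1 \<le> k" and j: "j < bsize k"
    have "Suc j \<le> bsize (Suc k)"
      using bsize_Suc[OF k] j by simp
    then show "U (f (?o k + j + 1)) \<in>
        complex_vector.span (f ` {1..?o (k + 1) + 0 * bsize k + j + 1})"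
      using f[of "?o (Suc k) + Suc j"] D_block[OF k, of "Suc j"] j by simp
  qed
  moreover have "staircase 1 V f"
    unfolding staircase_def
  proof (intro allI impI)
    fix k j
    assume k: "1 \<le> k" and j: "j < bsize k"
    have "bsize k + Suc j \<le> bsize (Suc k)"
      using bsize_Suc[OF k] j by simp
    then show "V (f (?o k + j + 1)) \<in>
        complex_vector.span (f ` {1..?o (k + 1) + 1 * bsize k + j + 1})"
      using f[of "?o (Suc k) + (bsize k + Suc j)"] D_block[OF k, of "bsize k + Suc j"] j
      by (simp add: add.assoc)
  qed
  moreover have span_e: "e n \<in> complex_vector.span (f ` {1..3 ^ n})" if n: "n \<ge> 1" for n
  proof (cases "n = 1")
    case True
    then show ?thesis
      unfolding True f1[symmetric] by (intro complex_vector.span_base imageI) simp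
  next
    case False
    \<comment> \<open>Index \<open>3 ^ n\<close> is the last place of block \<open>n + 1\<close>.
      For \<open>n > 1\<close> it lies in the third share, so \<open>e n\<close> is prescribed
      there.\<close>
    have "3 ^ n = ?o (Suc n) + bsize (Suc n)"
      using block_offset_bsize[of n] by (simp add: block_offset_Suc)
    moreover have "\<not> bsize (Suc n) \<le> 2 * bsize n" "\<not> bsize (Suc n) \<le> bsize n" "1 \<le> bsize (Suc n)"
      using bsize_Suc[OF n] bsize_pos[of n] False by auto
    ultimately show ?thesis
      using f[of "3 ^ n"] D_block[OF n, of "bsize (Suc n)"] by simp
  qed
  moreover have "orthonormal_basis f"
  proof -
    \<comment> \<open>Completeness of \<open>f\<close>: its span contains every \<open>e n\<close>,
      hence is dense because the span of \<open>e\<close> is.\<close>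
    have "e n \<in> complex_vector.span (f ` {1..})" if "n \<ge> 1" for n
      using span_e[OF that] by (rule subsetD[OF complex_vector.span_mono, rotated]) auto
    then have "complex_vector.span (e ` {1..}) \<subseteq> complex_vector.span (f ` {1..})"
      by (intro complex_vector.span_minimal) auto
    then have "closure (complex_vector.span (f ` {1..})) = UNIV"
      using closure_mono e unfolding orthonormal_basis_def by blast
    then show ?thesis
      using orth by (simp add: orthonormal_basis_def)
  qed
  ultimately show ?thesis
    using f1 by metis
qed

section \<open>Matrix entries that the staircases force to vanish\<close>

lemma staircase_cinner_eq_0:
  assumes "staircase d U f" and "orthonormal_basis f" and "k \<ge> 1" and "j < bsize k"
    and "m > block_offset bsize (Suc k) + d * bsize k + j + 1"
  shows "cinner (U (f (block_offset bsize k + j + 1))) (f m) = 0"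
proof (rule cinner_span_left_eq_0)
  show "U (f (block_offset bsize k + j + 1)) \<in>
      complex_vector.span (f ` {1..block_offset bsize (Suc k) + d * bsize k + j + 1})"
    using assms(1,3,4) by (simp add: staircase_def)
qed (use assms(2,5) orthonormal_basis_cinner[OF assms(2)] in auto)

text \<open>Block \<open>l + 1\<close> has room for at least two squares of size
  \<open>bsize l\<close>, so a staircase shifted by at most one square ends inside it and reaches no
  later block.\<close>

lemma staircase_below_eq_0:
  assumes "staircase d U f" and "orthonormal_basis f" and "d \<le> 1" and "l \<ge> 1"
    and "l + 1 < k" and "j < bsize l"
  shows "cinner (U (f (block_offset bsize l + j + 1))) (f (block_offset bsize k + i + 1)) = 0"
proof (rule staircase_cinner_eq_0[OF assms(1,2,4,6)])
  have "block_offset bsize (Suc (Suc l)) \<le> block_offset bsize k"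
    using assms(5) by (intro block_offset_mono) simp
  moreover have "d * bsize l \<le> bsize l"
    using assms(3) by (cases d) auto
  moreover have "block_offset bsize (Suc (Suc l)) \<ge> block_offset bsize (Suc l) + 2 * bsize l"
    using bsize_Suc[OF assms(4)] block_offset_Suc[of "Suc l" bsize] by simp
  ultimately show "block_offset bsize (Suc l) + d * bsize l + j + 1 < block_offset bsize k + i + 1"
    using assms(6) by linarith
qed

text \<open>The staircase of \<open>T\<close> clears the blocks below the subdiagonal; that of the
  adjoint \<open>S\<close>, read through conjugate transposition, clears those above the
  superdiagonal.\<close>

lemma block_tridiagonal_staircase:
  assumes adj: "\<And>x y. cinner (T x) y = cinner x (S y)"
    and f: "orthonormal_basis f" and st: "staircase c T f" "staircase d S f" and "c \<le> 1" "d \<le> 1"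
  shows "block_tridiagonal bsize T f"
  unfolding block_tridiagonal_def
proof (intro allI impI)
  fix k l :: nat
  assume kl: "1 \<le> k" "1 \<le> l" "k + 1 < l \<or> l + 1 < k"
  have "matrix_entry T f (block_offset bsize k + i + 1) (block_offset bsize l + j + 1) = 0"
    if "i < bsize k" "j < bsize l" for i j
    using kl(3)
  proof
    assume "l + 1 < k"
    then show ?thesis
      using staircase_below_eq_0[OF st(1) f] that assms kl by (simp add: matrix_entry_def)
  next
    assume "k + 1 < l"
    then show ?thesis
      using staircase_below_eq_0[OF st(2) f, of k l i j] that assms kl
      by (metis adj cinner_commute complex_cnj_zero matrix_entry_def)
  qed
  then show "block bsize T f k l = 0\<^sub>m (bsize k) (bsize l)"
    by (intro eq_matI) (auto simp: block_def)
qed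

lemma lower_block_staircase:
  assumes "orthonormal_basis f" and "staircase d T f" and "k \<ge> 1" and "i < bsize (Suc k)"
    and "j < bsize k" and "i > d * bsize k + j"
  shows "lower_block bsize T f k $$ (i, j) = 0"
  using staircase_cinner_eq_0[OF assms(2,1,3,5), of "block_offset bsize (Suc k) + i + 1"] assms
  by (simp add: block_def matrix_entry_def)

text \<open>An upper block of \<open>T\<close> is the conjugate transpose of the corresponding lower
  block of \<open>S\<close>, hence the swapped indices.\<close>

lemma upper_block_staircase:
  assumes adj: "\<And>x y. cinner (T x) y = cinner x (S y)"
    and "orthonormal_basis f" and "staircase d S f" and "k \<ge> 1" and "i < bsize (Suc k)"
    and "j < bsize k" and "i > d * bsize k + j"
  shows "upper_block bsize T f k $$ (j, i) = 0"
  using staircase_cinner_eq_0[OF assms(3,2,4,6), of "block_offset bsize (Suc k) + i + 1"] assms(4-)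
    cinner_commute[of "f (block_offset bsize (Suc k) + i + 1)"
      "S (f (block_offset bsize k + j + 1))"]
  by (simp add: block_def matrix_entry_def adj)

section \<open>Shapes of the off-diagonal blocks\<close>

lemma append_rows_split:
  assumes "M \<in> carrier_mat (p + q) c"
  shows "M = mat p c (\<lambda>(i, j). M $$ (i, j)) @\<^sub>r mat q c (\<lambda>(i, j). M $$ (p + i, j))"
  using assms by (intro eq_matI) (auto simp: append_rows_def)

lemma append_cols_split:
  assumes "M \<in> carrier_mat r (p + q)"
  shows "M = mat r p (\<lambda>(i, j). M $$ (i, j)) @\<^sub>c mat r q (\<lambda>(i, j). M $$ (i, p + j))"
  using assms by (intro eq_matI) (auto simp: append_cols_def)

lemma block_carrier: "block n T f k l \<in> carrier_mat (n k) (n l)"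
  by (simp add: block_def)

text \<open>With shift 0 the entries with \<open>i > j\<close> vanish. As
  \<open>j < bsize n\<close>, this gives both the triangular square on top and the zero rows under
  it.\<close>

lemma lower_block_shape_0:
  assumes f: "orthonormal_basis f" and st: "staircase 0 T f" and n: "n \<ge> 1"
  shows "\<exists>B'. B' \<in> carrier_mat (bsize n) (bsize n) \<and> upper_triangular B' \<and>
    lower_block bsize T f n = B' @\<^sub>r 0\<^sub>m (bsize (n + 1) - bsize n) (bsize n)"
proof -
  let ?n = "bsize n" and ?M = "lower_block bsize T f n"
  define q where "q = bsize (Suc n) - ?n"
  have q: "bsize (Suc n) = ?n + q"
    using bsize_Suc[OF n] by (simp add: q_def)
  have "?M = mat ?n ?n (\<lambda>(i, j). ?M $$ (i, j)) @\<^sub>r mat q ?n (\<lambda>(i, j). ?M $$ (?n + i, j))"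
    using block_carrier[of bsize T f "n + 1" n] q by (intro append_rows_split) simp
  moreover have "mat q ?n (\<lambda>(i, j). ?M $$ (?n + i, j)) = 0\<^sub>m q ?n"
    using lower_block_staircase[OF f st n] q by (intro eq_matI) auto
  moreover have "upper_triangular (mat ?n ?n (\<lambda>(i, j). ?M $$ (i, j)))"
    using lower_block_staircase[OF f st n] q by auto
  ultimately show ?thesis
    by (intro exI[of _ "mat ?n ?n (\<lambda>(i, j). ?M $$ (i, j))"]) (simp flip: q_def)
qed

lemma upper_block_shape_0:
  assumes adj: "\<And>x y. cinner (T x) y = cinner x (S y)"
    and f: "orthonormal_basis f" and st: "staircase 0 S f" and n: "n \<ge> 1"
  shows "\<exists>A'. A' \<in> carrier_mat (bsize n) (bsize n) \<and> lower_triangular A' \<and>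
    upper_block bsize T f n = A' @\<^sub>c 0\<^sub>m (bsize n) (bsize (n + 1) - bsize n)"
proof -
  let ?n = "bsize n" and ?M = "upper_block bsize T f n"
  define q where "q = bsize (Suc n) - ?n"
  have q: "bsize (Suc n) = ?n + q"
    using bsize_Suc[OF n] by (simp add: q_def)
  have "?M = mat ?n ?n (\<lambda>(i, j). ?M $$ (i, j)) @\<^sub>c mat ?n q (\<lambda>(i, j). ?M $$ (i, ?n + j))"
    using block_carrier[of bsize T f n "n + 1"] q by (intro append_cols_split) simp
  moreover have "mat ?n q (\<lambda>(i, j). ?M $$ (i, ?n + j)) = 0\<^sub>m ?n q"
    using upper_block_staircase[OF adj f st n] q by (intro eq_matI) auto
  moreover have "lower_triangular (mat ?n ?n (\<lambda>(i, j). ?M $$ (i, j)))"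
    using upper_block_staircase[OF adj f st n] q by (auto simp: lower_triangular_def)
  ultimately show ?thesis
    by (intro exI[of _ "mat ?n ?n (\<lambda>(i, j). ?M $$ (i, j))"]) (simp flip: q_def)
qed

text \<open>With shift 1 the entries with \<open>i > bsize n + j\<close> vanish: the first square is
  unrestricted, the second is upper triangular, and the rest is zero.\<close>

lemma lower_block_shape_1:
  assumes f: "orthonormal_basis f" and st: "staircase 1 T f" and n: "n \<ge> 1"
  shows "\<exists>B' B''. B' \<in> carrier_mat (bsize n) (bsize n) \<and>
    B'' \<in> carrier_mat (bsize n) (bsize n) \<and> upper_triangular B'' \<and>
    lower_block bsize T f n =
      (if n = 1 then B' @\<^sub>r B'' else B' @\<^sub>r B'' @\<^sub>r 0\<^sub>m (bsize n) (bsize n))"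
proof -
  let ?n = "bsize n" and ?M = "lower_block bsize T f n"
  \<comment> \<open>The height of the zero block. Allowing height 0 treats \<open>n = 1\<close>
    uniformly; the empty block is dropped at the end.\<close>
  define q where "q = (if n = 1 then 0 else ?n)"
  have q: "bsize (Suc n) = ?n + (?n + q)"
    using bsize_Suc[OF n] by (simp add: q_def)
  define B' where "B' = mat ?n ?n (\<lambda>(i, j). ?M $$ (i, j))"
  define R where "R = mat (?n + q) ?n (\<lambda>(i, j). ?M $$ (?n + i, j))"
  define B'' where "B'' = mat ?n ?n (\<lambda>(i, j). R $$ (i, j))"
  have "?M = B' @\<^sub>r R"
    unfolding B'_def R_def
    using block_carrier[of bsize T f "n + 1" n] q by (intro append_rows_split) simp
  moreover have "R = B'' @\<^sub>r mat q ?n (\<lambda>(i, j). R $$ (?n + i, j))"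
    unfolding B''_def by (intro append_rows_split) (simp add: R_def)
  moreover have "mat q ?n (\<lambda>(i, j). R $$ (?n + i, j)) = 0\<^sub>m q ?n"
    using lower_block_staircase[OF f st n] q by (intro eq_matI) (auto simp: R_def)
  moreover have "upper_triangular B''"
    using lower_block_staircase[OF f st n] q by (auto simp: B''_def R_def)
  moreover have "B'' @\<^sub>r 0\<^sub>m 0 ?n = B''"
    by (intro eq_matI) (auto simp: append_rows_def B''_def)
  ultimately show ?thesis
    by (intro exI[of _ B'] exI[of _ B'']) (auto simp: q_def B'_def B''_def)
qed

text \<open>The transposed counterpart of \<open>lower_block_shape_1\<close>, with the staircase of
  the adjoint restricting the columns.\<close>

lemma upper_block_shape_1:
  assumes adj: "\<And>x y. cinner (T x) y = cinner x (S y)"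
    and f: "orthonormal_basis f" and st: "staircase 1 S f" and n: "n \<ge> 1"
  shows "\<exists>A' A''. A' \<in> carrier_mat (bsize n) (bsize n) \<and>
    A'' \<in> carrier_mat (bsize n) (bsize n) \<and> lower_triangular A'' \<and>
    upper_block bsize T f n =
      (if n = 1 then A' @\<^sub>c A'' else A' @\<^sub>c A'' @\<^sub>c 0\<^sub>m (bsize n) (bsize n))"
proof -
  let ?n = "bsize n" and ?M = "upper_block bsize T f n"
  define q where "q = (if n = 1 then 0 else ?n)"
  have q: "bsize (Suc n) = ?n + (?n + q)"
    using bsize_Suc[OF n] by (simp add: q_def)
  define A' where "A' = mat ?n ?n (\<lambda>(i, j). ?M $$ (i, j))"
  define R where "R = mat ?n (?n + q) (\<lambda>(i, j). ?M $$ (i, ?n + j))"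
  define A'' where "A'' = mat ?n ?n (\<lambda>(i, j). R $$ (i, j))"
  have "?M = A' @\<^sub>c R"
    unfolding A'_def R_def
    using block_carrier[of bsize T f n "n + 1"] q by (intro append_cols_split) simp
  moreover have "R = A'' @\<^sub>c mat ?n q (\<lambda>(i, j). R $$ (i, ?n + j))"
    unfolding A''_def by (intro append_cols_split) (simp add: R_def)
  moreover have "mat ?n q (\<lambda>(i, j). R $$ (i, ?n + j)) = 0\<^sub>m ?n q"
    using upper_block_staircase[OF adj f st n] q by (intro eq_matI) (auto simp: R_def)
  moreover have "lower_triangular A''"
    using upper_block_staircase[OF adj f st n] q by (auto simp: A''_def R_def lower_triangular_def)
  moreover have "A'' @\<^sub>c 0\<^sub>m ?n 0 = A''"
    by (intro eq_matI) (auto simp: append_cols_def A''_def)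
  ultimately show ?thesis
    by (intro exI[of _ A'] exI[of _ A'']) (auto simp: q_def A'_def A''_def)
qed

theorem theorem2p8:
  fixes T :: "'a::chilbert_space \<Rightarrow> 'a" and e :: "nat \<Rightarrow> 'a"
  assumes separable: "separable_space (euclidean :: 'a topology)"
    and infinite_dimensional: "\<not> (\<exists>S :: 'a set. finite S \<and> complex_vector.span S = UNIV)"
    and T: "bounded_clinear T"
    and e: "orthonormal_basis e"
  shows
    "(\<exists>f. orthonormal_basis f \<and> block_tridiagonal bsize T f \<and>
        (\<forall>n\<ge>1. \<exists>B'. B' \<in> carrier_mat (bsize n) (bsize n) \<and> upper_triangular B' \<and>
           lower_block bsize T f n = B' @\<^sub>r 0\<^sub>m (bsize (n + 1) - bsize n) (bsize n)) \<and>
        (\<forall>n\<ge>1. \<exists>A' A''. A' \<in> carrier_mat (bsize n) (bsize n) \<and>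
           A'' \<in> carrier_mat (bsize n) (bsize n) \<and> lower_triangular A'' \<and>
           upper_block bsize T f n =
             (if n = 1 then A' @\<^sub>c A'' else A' @\<^sub>c A'' @\<^sub>c 0\<^sub>m (bsize n) (bsize n))) \<and>
        e 1 = f 1 \<and> (\<forall>n\<ge>1. e n \<in> complex_vector.span (f ` {1..3 ^ n}))) \<and>
     (\<exists>f. orthonormal_basis f \<and> block_tridiagonal bsize T f \<and>
        (\<forall>n\<ge>1. \<exists>A'. A' \<in> carrier_mat (bsize n) (bsize n) \<and> lower_triangular A' \<and>
           upper_block bsize T f n = A' @\<^sub>c 0\<^sub>m (bsize n) (bsize (n + 1) - bsize n)) \<and>
        (\<forall>n\<ge>1. \<exists>B' B''. B' \<in> carrier_mat (bsize n) (bsize n) \<and>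
           B'' \<in> carrier_mat (bsize n) (bsize n) \<and> upper_triangular B'' \<and>
           lower_block bsize T f n =
             (if n = 1 then B' @\<^sub>r B'' else B' @\<^sub>r B'' @\<^sub>r 0\<^sub>m (bsize n) (bsize n))) \<and>
        e 1 = f 1 \<and> (\<forall>n\<ge>1. e n \<in> complex_vector.span (f ` {1..3 ^ n})))"
proof -
  obtain S where adj: "\<And>x y. cinner (T x) y = cinner x (S y)"
    using adjoint_exists[OF T e] by blast
  \<comment> \<open>A staircase of \<open>T\<close> shapes the lower blocks and one of
    \<open>S\<close> the upper blocks. The operator with shift 0 gets the single square, so
    exchanging \<open>T\<close> and \<open>S\<close> exchanges the two forms.\<close>
  obtain f where f: "orthonormal_basis f" "staircase 0 T f" "staircase 1 S f"
      "e 1 = f 1" "\<forall>n\<ge>1. e n \<in> complex_vector.span (f ` {1..3 ^ n})"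
    using staircase_basis_exists[OF infinite_dimensional e, of T S] by auto
  obtain g where g: "orthonormal_basis g" "staircase 0 S g" "staircase 1 T g"
      "e 1 = g 1" "\<forall>n\<ge>1. e n \<in> complex_vector.span (g ` {1..3 ^ n})"
    using staircase_basis_exists[OF infinite_dimensional e, of S T] by auto
  have "block_tridiagonal bsize T f" "block_tridiagonal bsize T g"
    using block_tridiagonal_staircase[OF adj f(1-3)] block_tridiagonal_staircase[OF adj g(1,3,2)]
    by auto
  then show ?thesis
    using f g
    by (intro conjI exI[of _ f] exI[of _ g] allI impI lower_block_shape_0 lower_block_shape_1
        upper_block_shape_0[OF adj] upper_block_shape_1[OF adj]) auto
qed

end
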